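(* Let $\delta>0$ be an integer. The strength distribution of the weighted graphs $\mathcal{W}_n$ follows a power-law form $P_{\rm cum}(s)\sim s^{-(\gamma_s-1)}$ with the exponent $\gamma_s=1+\frac{\ln(\delta+4)}{\ln(\delta+2)}$.
   Context: The strength of a vertex $i$ in a weighted graph is $s_i=\sum_j w_{ij}$, the sum of the weights of its incident edges. The strength distribution $P(s)$ of a weighted graph is the probability that a randomly chosen vertex has strength $s$, and the cumulative strength distribution $P_{\rm cum}(s)=\sum_{s'\ge s}P(s')$ is the probability that a vertex has strength greater than or equal to $s$. A network with $P(s)\sim s^{-\gamma}$ is said to have a power-law strength distribution with exponent $\gamma$; its cumulative strength distribution is then also a power law, $P_{\rm cum}(s)\sim s^{-(\gamma-1)}$. The weighted graphs $\mathcal{W}_n$ ($n\ge 0$) are defined recursively for a fixed integer $\delta>0$. $\mathcal{W}_0$ is a triangle whose three edges have weight $1$. For $n\ge1$, $\mathcal{W}_n$ is obtained from $\mathcal{W}_{n-1}$ as follows: (I) for each vertex $i$ of $\mathcal{W}_{n-1}$, of strength $s_i$ in $\mathcal{W}_{n-1}$ (always an even integer), take $s_i/2$ new disjoint copies of $\mathcal{K}_2$ (two vertices joined by an edge of weight $1$) and join both vertices of each copy to $i$ by edges of weight $1$; (II) increase the weight $w$ of every edge that already belonged to $\mathcal{W}_{n-1}$ by $\delta w$, i.e. multiply it by $1+\delta$. *)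

theory Defs
  imports "HOL-Analysis.Analysis" "HOL-Library.Landau_Symbols"
begin

text \<open>
  Weighted graphs are given by a vertex set and a weight matrix, where weight 0 means
  ``no edge''. All weights occurring here are natural numbers.
\<close>

record 'a wgraph =
  verts :: "'a set"
  weight :: "'a \<Rightarrow> 'a \<Rightarrow> nat"

definition strength :: "'a wgraph \<Rightarrow> 'a \<Rightarrow> nat" where
  "strength G i = (\<Sum>j\<in>verts G. weight G i j)"

definition strength_dist :: "'a wgraph \<Rightarrow> nat \<Rightarrow> real" where
  "strength_dist G s = real (card {v \<in> verts G. strength G v = s}) / real (card (verts G))"

definition cum_strength_dist :: "'a wgraph \<Rightarrow> nat \<Rightarrow> real" where
  "cum_strength_dist G s = (\<Sum>\<^sub>\<infinity>s'\<in>{s..}. strength_dist G s')"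

text \<open>
  \<open>New n i k b\<close> is the endpoint \<open>b\<close> of the \<open>k\<close>-th copy of \<open>K\<^sub>2\<close> attached to the vertex \<open>i\<close>
  when passing from the \<open>n\<close>-th to the \<open>(n+1)\<close>-st graph. The label \<open>n\<close> makes the vertices
  added at different stages distinct.
\<close>

datatype vertex = Root nat | New nat vertex nat bool

definition copies :: "vertex wgraph \<Rightarrow> (vertex \<times> nat) set" where
  "copies G = {(i, k). i \<in> verts G \<and> k < strength G i div 2}"

definition new_edges :: "nat \<Rightarrow> vertex wgraph \<Rightarrow> vertex set set" where
  "new_edges n G =
     (\<Union>(i, k)\<in>copies G. {{New n i k False, New n i k True},
                            {i, New n i k False}, {i, New n i k True}})"

text \<open>
  In the weight of \<open>step\<close> at most one of the two summands is nonzero: an edge is either old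
  (and its weight \<open>w\<close> becomes \<open>w + \<delta> * w\<close>) or new (and has weight 1).
\<close>

definition step :: "nat \<Rightarrow> nat \<Rightarrow> vertex wgraph \<Rightarrow> vertex wgraph" where
  "step \<delta> n G =
     \<lparr> verts = verts G \<union> (\<Union>(i, k)\<in>copies G. {New n i k False, New n i k True}),
       weight = (\<lambda>u v. (weight G u v + \<delta> * weight G u v)
                        + (if {u, v} \<in> new_edges n G then 1 else 0)) \<rparr>"

definition triangle :: "vertex wgraph" where
  "triangle =
     \<lparr> verts = Root ` {..<3},
       weight = (\<lambda>u v. if u \<in> Root ` {..<3} \<and> v \<in> Root ` {..<3} \<and> u \<noteq> v then 1 else 0) \<rparr>"

primrec W :: "nat \<Rightarrow> nat \<Rightarrow> vertex wgraph" where
  "W \<delta> 0 = triangle"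
| "W \<delta> (Suc n) = step \<delta> n (W \<delta> n)"

definition attained_strengths :: "(nat \<Rightarrow> 'a wgraph) \<Rightarrow> nat set" where
  "attained_strengths G = (\<Union>n. strength (G n) ` verts (G n))"

text \<open>
  The meaning of \<open>P\<^sub>c\<^sub>u\<^sub>m(s) \<sim> s\<^bsup>-(\<gamma>-1)\<^esup>\<close> for a sequence of growing finite graphs, where the
  strengths may form a sparse set, so that \<open>P\<^sub>c\<^sub>u\<^sub>m\<close> is a step function of \<open>s\<close>.

  First, every single graph obeys the law up to constant factors which are independent of the
  graph, over the whole range of \<open>s\<close> up to its maximal strength (beyond which \<open>P\<^sub>c\<^sub>u\<^sub>m\<close> is 0).

  Second, in the limit of infinite size \<open>P\<^sub>c\<^sub>u\<^sub>m\<close> exists and is asymptotically equivalent to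
  a constant multiple of the power as \<open>s\<close> tends to infinity through the strengths that occur.
  At the other \<open>s\<close> a step function with sparse jumps is only of the same order as the power.
\<close>

definition power_law_strength :: "(nat \<Rightarrow> 'a wgraph) \<Rightarrow> real \<Rightarrow> bool" where
  "power_law_strength G \<gamma> \<longleftrightarrow>
     (\<exists>c>0. \<exists>C. \<forall>n. \<forall>s>0. (\<exists>v\<in>verts (G n). s \<le> strength (G n) v) \<longrightarrow>
        c * real s powr (-(\<gamma> - 1)) \<le> cum_strength_dist (G n) s \<and>
        cum_strength_dist (G n) s \<le> C * real s powr (-(\<gamma> - 1))) \<and>
     infinite (attained_strengths G) \<and>
     (\<exists>P. (\<forall>s. (\<lambda>n. cum_strength_dist (G n) s) \<longlonglongrightarrow> P s) \<and>
        (\<exists>A>0. P \<sim>[inf at_top (principal (attained_strengths G))]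
                   (\<lambda>s. A * real s powr (-(\<gamma> - 1)))))"

end

theory Submission imports Defs begin

text \<open>
  Put \<open>q = \<delta> + 2\<close> and \<open>p = \<delta> + 4\<close>. In one step the strength of an old vertex is multiplied by \<open>q\<close>,
  every new vertex gets strength 2, and there are as many new vertices as the total strength, which
  is therefore multiplied by \<open>p\<close>. Hence the vertices of \<open>\<W>\<^sub>n\<close> of strength at least
  \<open>2 q\<^sup>m\<close> are exactly those of \<open>\<W>\<^bsub>n-m\<^esub>\<close>, and the quotient of the two orders
  tends to \<open>p\<^bsup>-m\<^esup>\<close>, a constant times \<open>(2 q\<^sup>m)\<^bsup>- ln p / ln q\<^esup>\<close>.
\<close>

text \<open>Only finitely many strengths at or above \<open>s\<close> are attained, and all other
  terms of the infinite sum vanish. The remaining terms count the fibres of \<open>strength\<close>,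
  which partition the vertices selected by the threshold.\<close>

lemma cum_strength_dist_eq:
  assumes "finite (verts G)"
  shows "cum_strength_dist G s =
    real (card {v \<in> verts G. s \<le> strength G v}) / real (card (verts G))"
proof -
  let ?B = "{v \<in> verts G. s \<le> strength G v}"
  let ?F = "strength G ` ?B"
  have fin: "finite ?B" using assms by simp
  have "cum_strength_dist G s = (\<Sum>\<^sub>\<infinity>s'\<in>?F. strength_dist G s')"
    unfolding cum_strength_dist_def
  proof (rule infsum_cong_neutral)
    fix x assume "x \<in> {s..} - ?F"
    then have "{v \<in> verts G. strength G v = x} = {}" by auto
    then show "strength_dist G x = 0" by (simp add: strength_dist_def del: Collect_empty_eq)
  qed auto
  also have "\<dots> = (\<Sum>s'\<in>?F. real (card {v \<in> ?B. strength G v = s'})) / real (card (verts G))"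
    using fin by (auto simp: strength_dist_def sum_divide_distrib intro!: sum.cong arg_cong[where f = card])
  also have "(\<Sum>s'\<in>?F. real (card {v \<in> ?B. strength G v = s'})) = real (card ?B)"
  proof -
    have "card ?B = (\<Sum>s'\<in>?F. card {v \<in> ?B. strength G v = s'})"
      using sum.image_gen[OF fin, of "\<lambda>_. 1::nat" "strength G"] by simp
    then show ?thesis by simp
  qed
  finally show ?thesis .
qed

section \<open>One step of the construction\<close>

locale fresh_step =
  fixes G :: "vertex wgraph" and n \<delta> :: nat
  assumes finite_verts: "finite (verts G)"
    and fresh: "New n i k b \<notin> verts G"
    and weight_outside: "u \<notin> verts G \<or> v \<notin> verts G \<Longrightarrow> weight G u v = 0"
begin

lemma copies_eq: "copies G = (SIGMA i:verts G. {..<strength G i div 2})"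
  by (auto simp: copies_def)

lemma finite_copies: "finite (copies G)"
  using finite_verts by (simp add: copies_eq)

abbreviation new_verts :: "vertex set" where
  "new_verts \<equiv> (\<lambda>((i, k), b). New n i k b) ` (copies G \<times> UNIV)"

lemma verts_step: "verts (step \<delta> n G) = verts G \<union> new_verts"
  by (auto simp: step_def image_iff split: prod.splits)

lemma finite_new_verts: "finite new_verts"
  using finite_copies by simp

lemma finite_verts_step: "finite (verts (step \<delta> n G))"
  using finite_verts finite_new_verts by (simp add: verts_step)

lemma disjoint_new_verts: "verts G \<inter> new_verts = {}"
  using fresh by auto

lemma card_new_verts: "card new_verts = 2 * (\<Sum>i\<in>verts G. strength G i div 2)"
proof -
  have "inj_on (\<lambda>((i, k), b). New n i k b) (copies G \<times> UNIV)"
    by (auto simp: inj_on_def)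
  then show ?thesis
    using finite_verts by (simp add: card_image card_cartesian_product copies_eq)
qed

text \<open>By freshness an old vertex is never an endpoint of a new copy, so it lies on a new edge
  only as the vertex to which copies are attached.\<close>

lemma new_edges_old:
  assumes "v \<in> verts G"
  shows "{v, u} \<in> new_edges n G \<longleftrightarrow> (\<exists>k b. k < strength G v div 2 \<and> u = New n v k b)"
  using assms fresh
  by (auto simp: new_edges_def copies_def doubleton_eq_iff)

lemma new_edges_new:
  assumes "(i, k) \<in> copies G"
  shows "{New n i k b, u} \<in> new_edges n G \<longleftrightarrow> u = i \<or> u = New n i k (\<not> b)"
  using assms fresh
  by (cases b) (auto simp: new_edges_def copies_def doubleton_eq_iff)

lemma new_edges_subset:
  assumes "{u, v} \<in> new_edges n G"
  shows "u \<in> verts (step \<delta> n G)"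
  using assms by (auto simp: new_edges_def step_def copies_def doubleton_eq_iff)

lemma weight_outside_step:
  assumes "u \<notin> verts (step \<delta> n G) \<or> v \<notin> verts (step \<delta> n G)"
  shows "weight (step \<delta> n G) u v = 0"
proof -
  have "{u, v} \<notin> new_edges n G"
    using assms new_edges_subset[of u v] new_edges_subset[of v u] by (auto simp: insert_commute)
  moreover have "weight G u v = 0"
    using assms weight_outside by (auto simp: verts_step)
  ultimately show ?thesis by (simp add: step_def)
qed

text \<open>Old weights vanish outside the old vertex set, so the old part of the sum does not see
  the new vertices. Covering old and new \<open>v\<close> at once, the formula has
  \<open>strength G v\<close> as its sum in the first case and 0 in the second.\<close>

lemma strength_step:
  "strength (step \<delta> n G) v =
    (1 + \<delta>) * (\<Sum>u\<in>verts G. weight G v u) + card {u \<in> verts (step \<delta> n G). {v, u} \<in> new_edges n G}"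
proof -
  have "(\<Sum>u\<in>verts (step \<delta> n G). weight G v u) = (\<Sum>u\<in>verts G. weight G v u)"
    using finite_verts_step weight_outside by (intro sum.mono_neutral_right) (auto simp: verts_step)
  moreover have "weight (step \<delta> n G) v u =
      (1 + \<delta>) * weight G v u + (if {v, u} \<in> new_edges n G then 1 else 0)" for u
    by (simp add: step_def)
  moreover have "(\<Sum>u\<in>verts (step \<delta> n G). if {v, u} \<in> new_edges n G then 1 else 0 :: nat) =
      card {u \<in> verts (step \<delta> n G). {v, u} \<in> new_edges n G}"
    using finite_verts_step by (simp add: sum.If_cases Int_def)
  ultimately show ?thesis
    by (simp only: strength_def sum.distrib flip: sum_distrib_left)
qed

lemma strength_step_old:
  assumes "v \<in> verts G"
  shows "strength (step \<delta> n G) v = (1 + \<delta>) * strength G v + 2 * (strength G v div 2)"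
proof -
  let ?f = "\<lambda>(k, b). New n v k b"
  have "{u \<in> verts (step \<delta> n G). {v, u} \<in> new_edges n G} = ?f ` ({..<strength G v div 2} \<times> UNIV)"
  proof -
    have "New n v k b \<in> verts (step \<delta> n G)" if "k < strength G v div 2" for k b
      using assms that unfolding verts_step
      by (intro UnI2 image_eqI[where x = "((v, k), b)"]) (auto simp: copies_def)
    then show ?thesis
      by (auto simp: new_edges_old[OF assms])
  qed
  moreover have "inj_on ?f ({..<strength G v div 2} \<times> UNIV)"
    by (auto simp: inj_on_def)
  ultimately show ?thesis
    by (simp only: strength_step card_image card_cartesian_product)
       (simp add: strength_def)
qed

text \<open>The only neighbours are the other endpoint of the copy and the vertex it is attached to,
  which are distinct by freshness.\<close>

lemma strength_step_new:
  assumes "v \<in> new_verts"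
  shows "strength (step \<delta> n G) v = 2"
proof -
  obtain i k b where v: "v = New n i k b" and ik: "(i, k) \<in> copies G"
    using assms by auto
  have "New n i k (\<not> b) \<in> verts (step \<delta> n G)" "i \<in> verts (step \<delta> n G)"
    using ik unfolding verts_step by (auto simp: copies_def image_iff)
  then have "{u \<in> verts (step \<delta> n G). {v, u} \<in> new_edges n G} = {i, New n i k (\<not> b)}"
    by (auto simp: v new_edges_new[OF ik])
  moreover have "i \<noteq> New n i k (\<not> b)"
    using ik fresh by (auto simp: copies_def)
  moreover have "(\<Sum>u\<in>verts G. weight G v u) = 0"
    using fresh weight_outside by (simp add: v)
  ultimately show ?thesis by (simp add: strength_step)
qed

end

section \<open>Strengths and orders of the graphs\<close>

lemma fresh_step_W: "fresh_step (W \<delta> n) n"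
proof -
  \<comment> \<open>Absence of the single label \<open>n\<close> is not inductive; the invariant is
    that all labels are below \<open>n\<close>.\<close>
  have "finite (verts (W \<delta> n)) \<and> (\<forall>m i k b. New m i k b \<in> verts (W \<delta> n) \<longrightarrow> m < n) \<and>
    (\<forall>u v. u \<notin> verts (W \<delta> n) \<or> v \<notin> verts (W \<delta> n) \<longrightarrow> weight (W \<delta> n) u v = 0)"
  proof (induction n)
    case 0
    show ?case by (auto simp: triangle_def)
  next
    case (Suc n)
    then interpret fresh_step "W \<delta> n" n \<delta> by unfold_locales auto
    have "m < Suc n" if "New m i k b \<in> verts (step \<delta> n (W \<delta> n))" for m i k b
      using that Suc less_SucI[of m n] by (fastforce simp: verts_step)
    then show ?case
      using finite_verts_step weight_outside_step by simp
  qed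
  then show ?thesis by unfold_locales auto
qed

interpretation W: fresh_step "W \<delta> n" n \<delta> for \<delta> n
  by (rule fresh_step_W)

lemma card_verts_triangle: "card (verts triangle) = 3"
  by (simp add: triangle_def card_image inj_on_def)

lemma strength_W_0:
  assumes "v \<in> verts (W \<delta> 0)"
  shows "strength (W \<delta> 0) v = 2"
proof -
  have "strength (W \<delta> 0) v = (\<Sum>u\<in>verts triangle. if u \<noteq> v then 1 else 0)"
    using assms by (auto simp: strength_def triangle_def intro!: sum.cong)
  also have "\<dots> = card (verts triangle - {v})"
    by (simp add: sum.If_cases triangle_def Diff_eq Compl_eq)
  finally show ?thesis using assms by (simp add: card_verts_triangle)
qed

text \<open>The exponent \<open>j\<close> is the age of the vertex: it is born with strength 2, and
  every later step multiplies this by \<open>\<delta> + 2\<close>. In particular all strengths are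
  even.\<close>

lemma strength_W:
  "v \<in> verts (W \<delta> n) \<Longrightarrow> \<exists>j\<le>n. strength (W \<delta> n) v = 2 * (\<delta> + 2) ^ j"
proof (induction n arbitrary: v)
  case 0
  then show ?case using strength_W_0 by simp
next
  case (Suc n)
  show ?case
  proof (cases "v \<in> verts (W \<delta> n)")
    case True
    from Suc.IH[OF this] obtain j where "j \<le> n" "strength (W \<delta> n) v = 2 * (\<delta> + 2) ^ j" by blast
    with True show ?thesis
      by (intro exI[of _ "Suc j"]) (simp add: W.strength_step_old algebra_simps)
  next
    case False
    with Suc.prems have "v \<in> W.new_verts \<delta> n" by (simp only: W.simps W.verts_step) blast
    then show ?thesis by (intro exI[of _ 0]) (simp only: W.simps W.strength_step_new, simp)
  qed
qed

lemma strength_W_Suc: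
  assumes "v \<in> verts (W \<delta> n)"
  shows "strength (W \<delta> (Suc n)) v = (\<delta> + 2) * strength (W \<delta> n) v"
proof -
  have "even (strength (W \<delta> n) v)" using strength_W[OF assms] by auto
  then show ?thesis using assms by (simp add: W.strength_step_old algebra_simps)
qed

lemma card_new_verts_W: "card (W.new_verts \<delta> n) = (\<Sum>v\<in>verts (W \<delta> n). strength (W \<delta> n) v)"
  unfolding W.card_new_verts sum_distrib_left
  using strength_W by (intro sum.cong) fastforce+

lemma sum_strength_W: "(\<Sum>v\<in>verts (W \<delta> n). strength (W \<delta> n) v) = 6 * (\<delta> + 4) ^ n"
proof (induction n)
  case 0
  show ?case using strength_W_0 by (simp add: card_verts_triangle)
next
  case (Suc n)
  have "(\<Sum>v\<in>verts (W \<delta> (Suc n)). strength (W \<delta> (Suc n)) v) =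
      (\<Sum>v\<in>verts (W \<delta> n). strength (W \<delta> (Suc n)) v) + (\<Sum>v\<in>W.new_verts \<delta> n. strength (W \<delta> (Suc n)) v)"
    using W.finite_verts W.finite_new_verts W.disjoint_new_verts
    by (simp only: W.simps W.verts_step sum.union_disjoint)
  also have "(\<Sum>v\<in>verts (W \<delta> n). strength (W \<delta> (Suc n)) v) = (\<delta> + 2) * (6 * (\<delta> + 4) ^ n)"
    by (simp only: strength_W_Suc Suc.IH cong: sum.cong flip: sum_distrib_left)
  \<comment> \<open>The number of new vertices equals the old total strength, and each has strength
    2; this raises the factor \<open>\<delta> + 2\<close> to \<open>\<delta> + 4\<close>.\<close>
  also have "(\<Sum>v\<in>W.new_verts \<delta> n. strength (W \<delta> (Suc n)) v) = 2 * (6 * (\<delta> + 4) ^ n)"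
    by (simp only: W.simps W.strength_step_new sum_constant card_new_verts_W Suc.IH cong: sum.cong) simp
  finally show ?case by (simp add: algebra_simps)
qed

text \<open>This is the geometric sum 3 + 6 (1 + p + ... + p^(n-1)) with p = \<delta> + 4, over the
  denominator p - 1.\<close>

lemma card_verts_W:
  "real (card (verts (W \<delta> n))) = (3 * real \<delta> + 3 + 6 * (real \<delta> + 4) ^ n) / (real \<delta> + 3)"
proof (induction n)
  case 0
  show ?case by (simp add: card_verts_triangle field_simps)
next
  case (Suc n)
  have "card (verts (W \<delta> (Suc n))) = card (verts (W \<delta> n)) + 6 * (\<delta> + 4) ^ n"
    using W.finite_verts W.finite_new_verts W.disjoint_new_verts
    by (simp only: W.simps W.verts_step card_Un_disjoint card_new_verts_W sum_strength_W)
  then show ?case using Suc by (simp add: field_simps)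
qed

text \<open>Each unit of \<open>m\<close> peels off the newest generation: its vertices have
  strength 2, too small for the threshold, while for the older ones a factor
  \<open>\<delta> + 2\<close> cancels on both sides.\<close>

lemma verts_W_strength_ge:
  assumes "m \<le> n"
  shows "{v \<in> verts (W \<delta> n). 2 * (\<delta> + 2) ^ m \<le> strength (W \<delta> n) v} = verts (W \<delta> (n - m))"
  using assms
proof (induction m arbitrary: n)
  case 0
  have "2 \<le> strength (W \<delta> n) v" if "v \<in> verts (W \<delta> n)" for v
    using strength_W[OF that] by auto
  then show ?case by auto
next
  case (Suc m)
  then obtain n' where n: "n = Suc n'" by (cases n) auto
  have "{v \<in> verts (W \<delta> n). 2 * (\<delta> + 2) ^ Suc m \<le> strength (W \<delta> n) v} =
    {v \<in> verts (W \<delta> n'). 2 * (\<delta> + 2) ^ m \<le> strength (W \<delta> n') v}"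
  proof -
    have old: "2 * (\<delta> + 2) ^ Suc m \<le> strength (W \<delta> n) v \<longleftrightarrow> 2 * (\<delta> + 2) ^ m \<le> strength (W \<delta> n') v"
      if "v \<in> verts (W \<delta> n')" for v
    proof -
      have "2 * (\<delta> + 2) ^ Suc m \<le> strength (W \<delta> n) v \<longleftrightarrow>
          (\<delta> + 2) * (2 * (\<delta> + 2) ^ m) \<le> (\<delta> + 2) * strength (W \<delta> n') v"
        unfolding n strength_W_Suc[OF that] by (simp add: mult.left_commute)
      then show ?thesis by (simp only: mult_le_cancel1) simp
    qed
    have "1 < (\<delta> + 2) ^ Suc m" by (rule one_less_power) auto
    then have new: "\<not> 2 * (\<delta> + 2) ^ Suc m \<le> strength (W \<delta> n) v" if "v \<in> W.new_verts \<delta> n'" for v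
      using W.strength_step_new[OF that] by (simp only: n W.simps)
    have "verts (W \<delta> n) = verts (W \<delta> n') \<union> W.new_verts \<delta> n'"
      by (simp only: n W.simps W.verts_step)
    then show ?thesis using old new by blast
  qed
  then show ?case using Suc.IH[of n'] Suc.prems by (simp add: n)
qed

section \<open>Rounding thresholds up to strengths; formula, bounds and limit for the cumulative
  distribution\<close>

definition level :: "nat \<Rightarrow> nat \<Rightarrow> nat" where
  "level \<delta> s = (LEAST m. s \<le> 2 * (\<delta> + 2) ^ m)"

lemma le_level: "s \<le> 2 * (\<delta> + 2) ^ level \<delta> s"
  unfolding level_def
proof (rule LeastI)
  \<comment> \<open>Some exponent has to satisfy the condition under \<open>LEAST\<close>;
    \<open>s\<close> itself does.\<close>
  have "s < (\<delta> + 2) ^ s"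
    by (rule power_gt_expt) simp
  then show "s \<le> 2 * (\<delta> + 2) ^ s" by simp
qed

lemma level_le_iff: "level \<delta> s \<le> m \<longleftrightarrow> s \<le> 2 * (\<delta> + 2) ^ m"
proof
  assume "level \<delta> s \<le> m"
  then have "(\<delta> + 2) ^ level \<delta> s \<le> (\<delta> + 2) ^ m"
    by (intro power_increasing) auto
  then show "s \<le> 2 * (\<delta> + 2) ^ m" using le_level[of s \<delta>] by linarith
qed (simp add: level_def Least_le)

lemma level_strength: "level \<delta> (2 * (\<delta> + 2) ^ m) = m"
proof -
  have "level \<delta> (2 * (\<delta> + 2) ^ m) \<le> k \<longleftrightarrow> m \<le> k" for k
    by (simp add: level_le_iff power_increasing_iff)
  then show ?thesis by (metis le_antisym order_refl)
qed

text \<open>\<open>level\<close> rounds \<open>s\<close> up to the next number 2 q^m with q =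
  \<delta> + 2. All strengths have this form, so both thresholds select the same vertices, and the
  denominators \<open>\<delta> + 3\<close> of the two orders cancel.\<close>

lemma cum_strength_dist_W:
  assumes "level \<delta> s \<le> n"
  shows "cum_strength_dist (W \<delta> n) s =
    (3 * real \<delta> + 3 + 6 * (real \<delta> + 4) ^ (n - level \<delta> s)) / (3 * real \<delta> + 3 + 6 * (real \<delta> + 4) ^ n)"
proof -
  have "s \<le> strength (W \<delta> n) v \<longleftrightarrow> 2 * (\<delta> + 2) ^ level \<delta> s \<le> strength (W \<delta> n) v"
    if v: "v \<in> verts (W \<delta> n)" for v
  proof -
    obtain j where "strength (W \<delta> n) v = 2 * (\<delta> + 2) ^ j" using strength_W[OF v] by blast
    then show ?thesis using level_le_iff[of \<delta> s j] by (simp add: power_increasing_iff)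
  qed
  then have "{v \<in> verts (W \<delta> n). s \<le> strength (W \<delta> n) v} = verts (W \<delta> (n - level \<delta> s))"
    using verts_W_strength_ge[OF assms] by blast
  then show ?thesis
    by (simp add: cum_strength_dist_eq W.finite_verts card_verts_W)
qed

text \<open>The quotient is (c + 6b) / (c + 6ab) with a, b \<ge> 1. The lower bound 1/a uses c \<le>
  ca. The upper bound drops c from the denominator and uses c \<le> cb, at the cost of the factor (c
  + 6) / 6, which does not depend on n.\<close>

lemma cum_strength_dist_W_bounds:
  assumes "level \<delta> s \<le> n"
  shows "1 / (real \<delta> + 4) ^ level \<delta> s \<le> cum_strength_dist (W \<delta> n) s" (is ?lower)
    and "cum_strength_dist (W \<delta> n) s \<le> ((real \<delta> + 3) / 2) / (real \<delta> + 4) ^ level \<delta> s" (is ?upper)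
proof -
  let ?m = "level \<delta> s" and ?p = "real \<delta> + 4"
  define c where "c = 3 * real \<delta> + 3"
  define a where "a = ?p ^ ?m"
  define b where "b = ?p ^ (n - ?m)"
  have a: "a \<ge> 1" and b: "b \<ge> 1" and c: "c \<ge> 0"
    by (simp_all add: a_def b_def c_def one_le_power)
  have "?p ^ n = a * b" using assms by (simp add: a_def b_def flip: power_add)
  then have cum: "cum_strength_dist (W \<delta> n) s = (c + 6 * b) / (c + 6 * (a * b))"
    by (simp add: cum_strength_dist_W[OF assms] c_def b_def)
  have ab: "a * b > 0" using a b by simp
  then have pos: "c + 6 * (a * b) > 0" using c by linarith
  have "c \<le> c * a" using a c by (simp add: mult_le_cancel_left1)
  then show ?lower
    unfolding cum a_def[symmetric] using pos a by (simp add: field_simps)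
  have "c \<le> c * b" using b c by (simp add: mult_le_cancel_left1)
  moreover have "c + 6 * b > 0" using b c by linarith
  ultimately have "(c + 6 * b) / (c + 6 * (a * b)) \<le> ((c + 6) * b) / (6 * (a * b))"
    using c ab by (intro frac_le) (auto simp: algebra_simps)
  also have "\<dots> = ((c + 6) / 6) / a" using b by simp
  also have "(c + 6) / 6 = (real \<delta> + 3) / 2" by (simp add: c_def field_simps)
  finally show ?upper unfolding cum a_def .
qed

lemma cum_strength_dist_W_tendsto:
  "(\<lambda>n. cum_strength_dist (W \<delta> n) s) \<longlonglongrightarrow> 1 / (real \<delta> + 4) ^ level \<delta> s"
proof -
  let ?m = "level \<delta> s" and ?p = "real \<delta> + 4"
  define c where "c = 3 * real \<delta> + 3"
  \<comment> \<open>Numerator and denominator are divided by p^n, leaving (1/p)^n as the only term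
    that varies. The rewritten quotient agrees with the distribution once n reaches the
    level.\<close>
  have "(\<lambda>n. (1 / ?p) ^ n) \<longlonglongrightarrow> 0" by (rule LIMSEQ_realpow_zero) auto
  then have "(\<lambda>n. (c * (1 / ?p) ^ n + 6 * (1 / ?p ^ ?m)) / (c * (1 / ?p) ^ n + 6))
      \<longlonglongrightarrow> (c * 0 + 6 * (1 / ?p ^ ?m)) / (c * 0 + 6)"
    by (intro tendsto_intros) auto
  then have "(\<lambda>n. (c * (1 / ?p) ^ n + 6 * (1 / ?p ^ ?m)) / (c * (1 / ?p) ^ n + 6))
      \<longlonglongrightarrow> 1 / ?p ^ ?m" by simp
  moreover have "\<forall>\<^sub>F n in sequentially.
      (c * (1 / ?p) ^ n + 6 * (1 / ?p ^ ?m)) / (c * (1 / ?p) ^ n + 6) = cum_strength_dist (W \<delta> n) s"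
    using eventually_ge_at_top[of ?m]
  proof eventually_elim
    case (elim n)
    have "(c * (1 / ?p) ^ n + 6 * (1 / ?p ^ ?m)) / (c * (1 / ?p) ^ n + 6) =
        ((c * (1 / ?p) ^ n + 6 * (1 / ?p ^ ?m)) * ?p ^ n) / ((c * (1 / ?p) ^ n + 6) * ?p ^ n)"
      by simp
    also have "(c * (1 / ?p) ^ n + 6 * (1 / ?p ^ ?m)) * ?p ^ n = c + 6 * ?p ^ (n - ?m)"
      using elim by (simp add: distrib_right power_one_over power_diff)
    also have "(c * (1 / ?p) ^ n + 6) * ?p ^ n = c + 6 * ?p ^ n"
      by (simp add: distrib_right power_one_over)
    finally show ?case by (simp add: cum_strength_dist_W[OF elim] c_def)
  qed
  ultimately show ?thesis by (rule Lim_transform_eventually)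
qed

section \<open>The set of attained strengths\<close>

lemma Root_0_in_verts_W: "Root 0 \<in> verts (W \<delta> n)"
  by (induction n) (auto simp: triangle_def step_def)

lemma strength_Root_0: "strength (W \<delta> n) (Root 0) = 2 * (\<delta> + 2) ^ n"
proof (induction n)
  case 0
  show ?case using strength_W_0[OF Root_0_in_verts_W[of \<delta> 0]] by simp
next
  case (Suc n)
  then show ?case using strength_W_Suc[OF Root_0_in_verts_W] by simp
qed

text \<open>\<open>Root 0\<close> is present from the start, so its strengths at the successive
  stages run through all the values that \<open>strength_W\<close> permits.\<close>

lemma attained_strengths_W: "attained_strengths (W \<delta>) = range (\<lambda>j. 2 * (\<delta> + 2) ^ j)"
proof
  show "attained_strengths (W \<delta>) \<subseteq> range (\<lambda>j. 2 * (\<delta> + 2) ^ j)"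
    using strength_W by (fastforce simp: attained_strengths_def)
  show "range (\<lambda>j. 2 * (\<delta> + 2) ^ j) \<subseteq> attained_strengths (W \<delta>)"
    using Root_0_in_verts_W strength_Root_0 unfolding attained_strengths_def
    by (metis (no_types, lifting) UN_I UNIV_I image_eqI image_subsetI)
qed

lemma infinite_attained_strengths_W: "infinite (attained_strengths (W \<delta>))"
proof -
  have "inj (\<lambda>j. 2 * (\<delta> + 2) ^ j)"
    by (intro injI) (simp add: power_inject_exp)
  then show ?thesis by (simp only: attained_strengths_W range_inj_infinite not_False_eq_True)
qed

section \<open>Comparison with the power of s\<close>

context
  fixes \<delta> :: nat and \<alpha> :: real
  assumes \<alpha>: "\<alpha> = ln (real \<delta> + 4) / ln (real \<delta> + 2)"
begin

lemma exponent_nonneg: "\<alpha> \<ge> 0"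
  unfolding \<alpha> by (intro divide_nonneg_nonneg) simp_all

text \<open>The exponent is chosen so that (\<delta> + 2)^\<alpha> = \<delta> + 4: passing to the
  next strength divides the power by exactly \<delta> + 4, as it does the limiting
  distribution.\<close>

lemma powr_strength:
  "real (2 * (\<delta> + 2) ^ j) powr - \<alpha> = 2 powr - \<alpha> / (real \<delta> + 4) ^ j"
proof -
  have "(real \<delta> + 2) powr \<alpha> = real \<delta> + 4"
    by (simp add: \<alpha> powr_def)
  moreover have "((real \<delta> + 2) ^ j) powr - \<alpha> = inverse (((real \<delta> + 2) powr \<alpha>) ^ j)"
    by (simp add: powr_minus powr_powr mult.commute flip: powr_realpow)
  ultimately show ?thesis by (simp add: powr_mult divide_inverse add.commute)
qed

lemma powr_level_lower:
  assumes "s > 0"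
  shows "1 / (real \<delta> + 4) * real s powr - \<alpha> \<le> 1 / (real \<delta> + 4) ^ level \<delta> s"
proof (cases "level \<delta> s")
  case 0
  \<comment> \<open>At level 0 there is no preceding strength to compare with, but s \<ge> 1
    suffices.\<close>
  have "real s powr - \<alpha> \<le> 1 powr - \<alpha>"
    using assms exponent_nonneg by (intro powr_mono2') auto
  then show ?thesis by (simp add: 0 field_simps)
next
  case (Suc m)
  \<comment> \<open>By minimality of the level, s exceeds the preceding strength; replacing one by
    the other costs the factor 1 / (\<delta> + 4) in the claim.\<close>
  then have "2 * (\<delta> + 2) ^ m \<le> s" using level_le_iff[of \<delta> s m] by linarith
  then have "real (2 * (\<delta> + 2) ^ m) \<le> real s" by (simp only: of_nat_le_iff)
  then have "real s powr - \<alpha> \<le> real (2 * (\<delta> + 2) ^ m) powr - \<alpha>"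
    using exponent_nonneg by (intro powr_mono2') auto
  also have "\<dots> \<le> 1 / (real \<delta> + 4) ^ m"
  proof -
    have "2 powr - \<alpha> \<le> 2 powr 0" using exponent_nonneg by (intro powr_mono) auto
    then show ?thesis unfolding powr_strength by (intro divide_right_mono) auto
  qed
  finally have "real s powr - \<alpha> / (real \<delta> + 4) \<le> 1 / (real \<delta> + 4) ^ m / (real \<delta> + 4)"
    by (intro divide_right_mono) auto
  then show ?thesis by (simp add: Suc mult.commute)
qed

text \<open>Rounding s up to a strength can only decrease the power, and there
  \<open>powr_strength\<close> gives equality; the factor 2^\<alpha> offsets the 2 in the
  strengths.\<close>

lemma powr_level_upper:
  assumes "s > 0"
  shows "1 / (real \<delta> + 4) ^ level \<delta> s \<le> 2 powr \<alpha> * real s powr - \<alpha>"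
proof -
  have "real s \<le> real (2 * (\<delta> + 2) ^ level \<delta> s)"
    using le_level by (simp only: of_nat_le_iff)
  then have "real (2 * (\<delta> + 2) ^ level \<delta> s) powr - \<alpha> \<le> real s powr - \<alpha>"
    using assms exponent_nonneg by (intro powr_mono2') auto
  then have "2 powr \<alpha> * (2 powr - \<alpha> / (real \<delta> + 4) ^ level \<delta> s) \<le> 2 powr \<alpha> * real s powr - \<alpha>"
    unfolding powr_strength by (intro mult_left_mono) auto
  then show ?thesis by (simp add: powr_minus)
qed

lemma power_law_strength_W: "power_law_strength (W \<delta>) (1 + \<alpha>)"
proof -
  let ?p = "real \<delta> + 4" and ?A = "attained_strengths (W \<delta>)"
  define C where "C = (real \<delta> + 3) / 2"
  have "1 / ?p * real s powr - \<alpha> \<le> cum_strength_dist (W \<delta> n) s \<and>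
      cum_strength_dist (W \<delta> n) s \<le> C * 2 powr \<alpha> * real s powr - \<alpha>"
    if s: "s > 0" and ex: "\<exists>v\<in>verts (W \<delta> n). s \<le> strength (W \<delta> n) v" for n s
  proof -
    \<comment> \<open>That s does not exceed the maximal strength is what puts its level within the
      range 0..n of the bounds.\<close>
    obtain v j where "s \<le> strength (W \<delta> n) v" "j \<le> n" "strength (W \<delta> n) v = 2 * (\<delta> + 2) ^ j"
      using ex strength_W by blast
    then have level: "level \<delta> s \<le> n" using level_le_iff[of \<delta> s j] by simp
    have "cum_strength_dist (W \<delta> n) s \<le> C * (1 / ?p ^ level \<delta> s)"
      using cum_strength_dist_W_bounds(2)[OF level] by (simp add: C_def)
    also have "\<dots> \<le> C * (2 powr \<alpha> * real s powr - \<alpha>)"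
      using powr_level_upper[OF s] by (intro mult_left_mono) (auto simp: C_def)
    finally show ?thesis
      using cum_strength_dist_W_bounds(1)[OF level] powr_level_lower[OF s]
      by (simp add: mult.assoc)
  qed
  then have "\<exists>c>0. \<exists>C. \<forall>n. \<forall>s>0. (\<exists>v\<in>verts (W \<delta> n). s \<le> strength (W \<delta> n) v) \<longrightarrow>
      c * real s powr - \<alpha> \<le> cum_strength_dist (W \<delta> n) s \<and>
      cum_strength_dist (W \<delta> n) s \<le> C * real s powr - \<alpha>"
    by (intro exI[of _ "1 / ?p"] exI[of _ "C * 2 powr \<alpha>"] conjI allI impI) auto
  moreover have "(\<lambda>s. 1 / ?p ^ level \<delta> s) \<sim>[inf at_top (principal ?A)]
      (\<lambda>s. 2 powr \<alpha> * real s powr - \<alpha>)"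
  proof (rule asymp_equiv_refl_ev)
    have "1 / ?p ^ level \<delta> s = 2 powr \<alpha> * real s powr - \<alpha>" if "s \<in> ?A" for s
    proof -
      obtain j where s: "s = 2 * (\<delta> + 2) ^ j" using \<open>s \<in> ?A\<close> by (auto simp: attained_strengths_W)
      show ?thesis unfolding s level_strength powr_strength by (simp add: powr_minus)
    qed
    then show "\<forall>\<^sub>F s in inf at_top (principal ?A). 1 / ?p ^ level \<delta> s = 2 powr \<alpha> * real s powr - \<alpha>"
      by (simp add: eventually_inf_principal)
  qed
  ultimately show ?thesis
    unfolding power_law_strength_def
    using infinite_attained_strengths_W cum_strength_dist_W_tendsto
    by (auto intro!: exI[of _ "\<lambda>s. 1 / ?p ^ level \<delta> s"] exI[of _ "2 powr \<alpha>"])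
qed

end

theorem proposition3p1:
  fixes \<delta> :: nat
  assumes "\<delta> > 0"
  shows "power_law_strength (W \<delta>) (1 + ln (real \<delta> + 4) / ln (real \<delta> + 2))"
  by (rule power_law_strength_W) (rule refl)

end
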